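(* Let $\chi=\chi(t,k)$ be the unique formal power series in $t$ with zero constant term (and with coefficients polynomials in $k$) satisfying \[k(1+\chi)\log(1+\chi)=(k+1)\chi-t.\] For integers $l\ge 1$ and $n\ge 0$ let $\mu_l(n)$ be the coefficient of $k^{n-l}t^n/n!$ in $\chi(t,k)$, and let $M_l(u)$ denote $\sum_{n=0}^\infty \mu_l(n)\,t^n/n!$ regarded as a function of $u=\sqrt{1-2t}$ (i.e. with $t=\tfrac12(1-u^2)$). Then $M_l(u)$ is a Laurent polynomial in $u$ in which every negative power of $u$ that occurs with nonzero coefficient is odd.
   Context: The coefficient of $t^n$ in $\chi(t,k)$ is a polynomial in $k$ of degree $n-1$; e.g. $\chi(t,k)=t+k\,t^2/2!+(3k^2-k)t^3/3!+\cdots$. It is known (Goulden, Litsyn, Shevelev) that for each $l$ the series $\sum_n \mu_l(n)t^n/n!$ is a Laurent polynomial $M_l(u)$ in $u=\sqrt{1-2t}$; e.g. $M_1(u)=1-u$, $M_2(u)=-\tfrac16u^{-1}+\tfrac12-\tfrac12u+\tfrac16u^2$. *)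

theory Defs
  imports
    "HOL-Computational_Algebra.Computational_Algebra"
    "HOL-Library.Poly_Mapping"
begin

text \<open>
  Series in \<open>t\<close> whose coefficients are polynomials in \<open>k\<close> have type \<open>rat poly fps\<close>:
  \<^const>\<open>fps_X\<close> is \<open>t\<close>, and \<open>k\<close> is the constant series \<open>k_fps\<close>.
\<close>

definition k_fps :: "rat poly fps" where
  "k_fps = fps_const [:0, 1:]"

text \<open>\<^term>\<open>fps_ln 1\<close> is the series of \<open>log (1 + X)\<close>. It lives over a field, so it is
  mapped coefficientwise to constant polynomials in \<open>k\<close>.\<close>

definition log1p_fps :: "rat poly fps" where
  "log1p_fps = Abs_fps (\<lambda>n. [:fps_ln 1 $ n:])"

definition is_chi :: "rat poly fps \<Rightarrow> bool" where
  "is_chi \<chi> \<longleftrightarrow>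
     \<chi> $ 0 = 0 \<and>
     k_fps * (1 + \<chi>) * (log1p_fps oo \<chi>) = (k_fps + 1) * \<chi> - fps_X"

definition chi :: "rat poly fps" where
  "chi = (THE \<chi>. is_chi \<chi>)"

text \<open>For \<open>n < l\<close> the power \<open>k\<^sup>n\<^sup>-\<^sup>l\<close> is negative and the coefficient is 0; the case
  distinction is needed because subtraction on \<open>nat\<close> truncates.\<close>

definition mu :: "nat \<Rightarrow> nat \<Rightarrow> rat" where
  "mu l n = (if l \<le> n then fact n * coeff (chi $ n) (n - l) else 0)"

definition mu_egf :: "nat \<Rightarrow> rat fps" where
  "mu_egf l = Abs_fps (\<lambda>n. mu l n / fact n)"

text \<open>\<open>u = (1 - 2 t)\<^sup>1\<^sup>/\<^sup>2\<close>, with constant term 1; see \<open>u_fps_square\<close>.\<close>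

definition u_fps :: "rat fps" where
  "u_fps = fps_binomial (1/2) oo (- 2 * fps_X)"

text \<open>Laurent polynomials over \<open>rat\<close> in one variable are the finitely supported maps
  \<open>int \<Rightarrow>\<^sub>0 rat\<close> from exponents to coefficients. They can be evaluated at a power series
  with nonzero constant term, where \<open>powi\<close> with a negative exponent is a power of
  the inverse series.\<close>

definition laurent_eval :: "(int \<Rightarrow>\<^sub>0 rat) \<Rightarrow> rat fps \<Rightarrow> rat fps" where
  "laurent_eval P f = (\<Sum>i\<in>Poly_Mapping.keys P. fps_const (Poly_Mapping.lookup P i) * f powi i)"

lemma u_fps_nth_0: "u_fps $ 0 = 1"
  by (simp add: u_fps_def fps_binomial_def)

lemma u_fps_square: "u_fps\<^sup>2 = 1 - 2 * fps_X"
proof -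
  have 0: "(- 2 * fps_X :: rat fps) $ 0 = 0" by simp
  have "u_fps\<^sup>2 = (fps_binomial (1/2) * fps_binomial (1/2)) oo (- 2 * fps_X)"
    unfolding u_fps_def power2_eq_square by (rule fps_compose_mult_distrib [OF 0, symmetric])
  also have "fps_binomial (1/2) * fps_binomial (1/2) = (fps_binomial 1 :: rat fps)"
    by (simp flip: fps_binomial_add_mult)
  also have "\<dots> oo (- 2 * fps_X) = 1 - 2 * fps_X"
    by (simp add: fps_binomial_1 fps_compose_add_distrib)
  finally show ?thesis .
qed

text \<open>Existence and uniqueness of \<open>\<chi>\<close>: the equation is equivalent to the fixed-point
  equation \<open>\<chi> = t + k G(\<chi>)\<close> with \<open>G(x) = (1 + x) log (1 + x) - x = O(x\<^sup>2)\<close>,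
  whose right-hand side is a contraction.\<close>

definition G_fps :: "rat poly fps" where
  "G_fps = (1 + fps_X) * log1p_fps - fps_X"

lemma G_fps_low: "G_fps $ 0 = 0" "G_fps $ Suc 0 = 0"
  by (simp_all add: G_fps_def log1p_fps_def fps_ln_nth distrib_right fps_mult_nth one_pCons)

lemma is_chi_iff: "is_chi \<chi> \<longleftrightarrow> \<chi> $ 0 = 0 \<and> \<chi> = fps_X + k_fps * (G_fps oo \<chi>)"
proof (cases "\<chi> $ 0 = 0")
  case True
  then have G: "G_fps oo \<chi> = (1 + \<chi>) * (log1p_fps oo \<chi>) - \<chi>"
    by (simp add: G_fps_def fps_compose_sub_distrib fps_compose_mult_distrib
        fps_compose_add_distrib)
  have *: "fps_X + k_fps * (G_fps oo \<chi>) =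
      fps_X + k_fps * (1 + \<chi>) * (log1p_fps oo \<chi>) - k_fps * \<chi>"
    unfolding G by (simp add: algebra_simps)
  show ?thesis
    unfolding is_chi_def * using True by (auto simp: algebra_simps)
qed (simp add: is_chi_def)

lemma fps_power_nth_cong:
  fixes f g :: "'a::comm_ring_1 fps"
  assumes "f $ 0 = 0" "g $ 0 = 0" "\<And>m. m < n \<Longrightarrow> f $ m = g $ m" "2 \<le> i"
  shows "f ^ i $ n = g ^ i $ n"
  using \<open>2 \<le> i\<close>
proof -
  have low: "f ^ j $ m = g ^ j $ m" if "m < n" for j m
    using that
  proof (induction j arbitrary: m)
    case (Suc j)
    then show ?case by (auto simp: fps_mult_nth assms(3) intro!: sum.cong)
  qed simp
  obtain j where i: "i = Suc j" "j \<noteq> 0" using \<open>2 \<le> i\<close> by (cases i) auto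
  have "f $ m * f ^ j $ (n - m) = g $ m * g ^ j $ (n - m)" if "m \<le> n" for m
  proof (cases "m = 0 \<or> m = n")
    case True
    then show ?thesis using assms(1,2) i(2) by (auto simp: fps_power_zeroth power_0_left)
  next
    case False
    then show ?thesis using low[of "n - m" j] assms(3)[of m] that by simp
  qed
  then show ?thesis unfolding i(1) by (simp add: fps_mult_nth)
qed

lemma G_compose_cong:
  assumes "f $ 0 = 0" "g $ 0 = 0" "\<And>m. m < n \<Longrightarrow> f $ m = g $ m"
  shows "(G_fps oo f) $ n = (G_fps oo g) $ n"
  unfolding fps_compose_nth
proof (intro sum.cong refl)
  fix i :: nat
  consider "i = 0" | "i = 1" | "2 \<le> i" by linarith
  then show "G_fps $ i * f ^ i $ n = G_fps $ i * g ^ i $ n"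
    by cases (simp_all add: G_fps_low fps_power_nth_cong [OF assms])
qed

lemma chi_ex1: "\<exists>!\<chi>. is_chi \<chi>"
proof -
  define T where "T = (\<lambda>\<chi>. fps_X + k_fps * (G_fps oo \<chi>))"
  have T0: "T \<chi> $ 0 = 0" for \<chi>
    by (simp add: T_def fps_compose_nth G_fps_low)
  have Tcong: "T f $ n = T g $ n"
    if "f $ 0 = 0" "g $ 0 = 0" "\<And>m. m < n \<Longrightarrow> f $ m = g $ m" for f g n
    using G_compose_cong [OF that] by (simp add: T_def k_fps_def)
  define s where "s = (\<lambda>n. (T ^^ n) 0)"
  have s0: "s n $ 0 = 0" for n
    by (cases n) (simp_all add: s_def T0)
  have sS: "s (Suc n) = T (s n)" for n
    by (simp add: s_def)
  have s_eq: "s n $ m = s (Suc n) $ m" if "m < n" for n m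
    using that
  proof (induction n arbitrary: m)
    case (Suc n)
    have "T (s n) $ m = T (s (Suc n)) $ m"
      by (rule Tcong [OF s0 s0]) (use Suc in auto)
    then show ?case by (simp only: sS)
  qed simp
  define L where "L = Abs_fps (\<lambda>n. s (Suc n) $ n)"
  have Ls: "L $ m = s n $ m" if "m < n" for m n
  proof -
    from that have "Suc m \<le> n" by simp
    then show ?thesis
    proof (induction n rule: dec_induct)
      case base
      then show ?case by (simp add: L_def)
    next
      case (step n)
      then have "m < n" by simp
      from s_eq [OF this] step.IH show ?case by (rule trans [rotated])
    qed
  qed
  have L0: "L $ 0 = 0" by (simp add: L_def s0)
  have "L = T L"
  proof (rule fps_ext)
    fix n
    have "T L $ n = T (s n) $ n"
      by (rule Tcong [OF L0 s0]) (rule Ls)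
    then show "L $ n = T L $ n" by (simp add: L_def sS)
  qed
  then have "is_chi L" using L0 unfolding is_chi_iff T_def by simp
  moreover have "f = g" if "is_chi f" "is_chi g" for f g
  proof (rule fps_ext)
    from that have fg: "f $ 0 = 0" "g $ 0 = 0" "T f = f" "T g = g"
      by (auto simp: is_chi_iff T_def)
    fix n
    show "f $ n = g $ n"
    proof (induction n rule: less_induct)
      case (less n)
      then show ?case using Tcong [OF fg(1,2), of n] fg(3,4) by simp
    qed
  qed
  ultimately show ?thesis by blast
qed

lemma is_chi_chi: "is_chi chi"
  unfolding chi_def by (rule theI' [OF chi_ex1])

end

theory Submission
  imports Defs
begin

text \<open>
  Put \<open>h = 1 / k\<close>. Then \<open>X = \<Sum>\<^sub>l M\<^sub>l h\<^sup>l\<close> is \<open>\<chi>(h t, 1 / h)\<close>, which satisfies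
  \<open>(1 + X) log (1 + X) = (1 + h) X - h\<^sup>2 t\<close>. Moving the critical point of this equation to
  the origin by \<open>1 + X = e\<^sup>h (1 + S)\<close> turns it into
  \<open>(1 + S) log (1 + S) - S = x\<^sup>2 / 2\<close> with \<open>x\<^sup>2 = 2 - 2 (1 + h + h\<^sup>2 t) e\<^sup>-\<^sup>h\<close>, so
  \<open>S = \<phi>(x)\<close> for a fixed power series \<open>\<phi>\<close>. The coefficients of \<open>x\<^sup>2\<close> with respect to \<open>h\<close>
  are polynomials in \<open>t = (1 - u\<^sup>2) / 2\<close>, while \<open>x\<close> itself is \<open>u\<close> times a series in \<open>h\<close> whose
  coefficients are Laurent polynomials in \<open>u\<^sup>2\<close>. Hence the even powers of \<open>x\<close> contribute only
  nonnegative powers of \<open>u\<close>, and the odd powers of \<open>x\<close> only odd powers of \<open>u\<close>.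

  Differentiating with respect to \<open>t\<close> eliminates the logarithm: \<open>X\<close> is the unique solution
  of \<open>X' (h + h\<^sup>2 t - X) = h\<^sup>2 (1 + X)\<close> without constant terms in \<open>h\<close> and in \<open>t\<close>.
\<close>

section \<open>Coefficientwise maps of power series\<close>

definition fps_map :: "('a \<Rightarrow> 'b) \<Rightarrow> 'a::zero fps \<Rightarrow> 'b::zero fps" where
  "fps_map f F = Abs_fps (\<lambda>n. f (F $ n))"

lemma fps_map_nth [simp]: "fps_map f F $ n = f (F $ n)"
  by (simp add: fps_map_def)

text \<open>Covers the three coefficient maps of the proof: constants into series in t, evaluation
  at t = 0, and constant polynomials in k.\<close>

locale comm_ring_hom =
  fixes hom :: "'a::comm_ring_1 \<Rightarrow> 'b::comm_ring_1"
  assumes hom_one: "hom 1 = 1"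
    and hom_add: "hom (x + y) = hom x + hom y"
    and hom_mult: "hom (x * y) = hom x * hom y"
begin

lemma hom_zero: "hom 0 = 0"
  using hom_add[of 0 0] by simp

lemma hom_uminus: "hom (- x) = - hom x"
  using hom_add[of x "- x"] by (simp add: hom_zero add_eq_0_iff)

lemma hom_diff: "hom (x - y) = hom x - hom y"
  using hom_add[of x "- y"] by (simp add: hom_uminus)

lemma hom_sum: "hom (sum f A) = (\<Sum>a\<in>A. hom (f a))"
  by (induction A rule: infinite_finite_induct) (simp_all add: hom_zero hom_add)

lemma fps_map_one: "fps_map hom 1 = 1"
  by (simp add: fps_eq_iff hom_one hom_zero)

lemma fps_map_add: "fps_map hom (F + G) = fps_map hom F + fps_map hom G"
  by (simp add: fps_eq_iff hom_add)

lemma fps_map_diff: "fps_map hom (F - G) = fps_map hom F - fps_map hom G"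
  by (simp add: fps_eq_iff hom_diff)

lemma fps_map_mult: "fps_map hom (F * G) = fps_map hom F * fps_map hom G"
  by (simp add: fps_eq_iff fps_mult_nth hom_sum hom_mult)

lemma fps_map_power: "fps_map hom (F ^ n) = fps_map hom F ^ n"
  by (induction n) (simp_all add: fps_map_one fps_map_mult)

lemma fps_map_fps_X: "fps_map hom fps_X = fps_X"
  by (simp add: fps_eq_iff hom_one hom_zero fps_X_def)

lemma fps_map_fps_const: "fps_map hom (fps_const c) = fps_const (hom c)"
  by (simp add: fps_eq_iff hom_zero)

lemma fps_map_compose: "fps_map hom (F oo G) = fps_map hom F oo fps_map hom G"
proof (rule fps_ext)
  fix n
  have "hom (G ^ i $ n) = fps_map hom G ^ i $ n" for i
    using arg_cong[OF fps_map_power[of G i], of "\<lambda>H. H $ n"] by simp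
  then show "fps_map hom (F oo G) $ n = (fps_map hom F oo fps_map hom G) $ n"
    by (simp add: fps_compose_nth hom_sum hom_mult)
qed

end

interpretation fps_const_hom: comm_ring_hom "fps_const :: 'a::comm_ring_1 \<Rightarrow> 'a fps"
  by standard simp_all

interpretation fps_nth_0_hom: comm_ring_hom "(\<lambda>F. F $ 0) :: 'a::comm_ring_1 fps \<Rightarrow> 'a"
  by standard simp_all

text \<open>In \<^typ>\<open>rat fps fps\<close> the outer variable is \<open>h = 1 / k\<close> and the inner one is \<open>t\<close>.\<close>

abbreviation lift :: "'a::comm_ring_1 fps \<Rightarrow> 'a fps fps" where
  "lift \<equiv> fps_map fps_const"

abbreviation at_0 :: "'a::comm_ring_1 fps fps \<Rightarrow> 'a fps" where
  "at_0 \<equiv> fps_map (\<lambda>F. F $ 0)"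

abbreviation deriv_t :: "'a::comm_ring_1 fps fps \<Rightarrow> 'a fps fps" where
  "deriv_t \<equiv> fps_map fps_deriv"

lemma at_0_lift [simp]: "at_0 (lift F) = F"
  by (simp add: fps_eq_iff)

lemma deriv_t_lift [simp]: "deriv_t (lift F) = 0"
  by (simp add: fps_eq_iff)

lemma deriv_t_fps_X [simp]: "deriv_t fps_X = 0"
  by (simp add: fps_eq_iff fps_X_def)

lemma deriv_t_one [simp]: "deriv_t 1 = 0"
  by (simp add: fps_eq_iff)

lemma deriv_t_fps_const [simp]: "deriv_t (fps_const c) = fps_const (fps_deriv c)"
  by (simp add: fps_eq_iff)

lemma deriv_t_add [simp]: "deriv_t (F + G) = deriv_t F + deriv_t G"
  by (simp add: fps_eq_iff)

lemma deriv_t_diff [simp]: "deriv_t (F - G) = deriv_t F - deriv_t G"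
  by (simp add: fps_eq_iff)

lemma deriv_t_mult [simp]: "deriv_t (F * G) = deriv_t F * G + F * deriv_t G"
proof (rule fps_ext)
  fix n
  show "deriv_t (F * G) $ n = (deriv_t F * G + F * deriv_t G) $ n"
    unfolding fps_map_nth fps_add_nth fps_mult_nth fps_deriv_sum sum.distrib[symmetric]
    by (simp add: add.commute)
qed

lemma deriv_t_power: "deriv_t (F ^ n) = of_nat n * F ^ (n - 1) * deriv_t F"
proof (induction n)
  case (Suc n)
  then show ?case by (cases n) (simp_all add: algebra_simps)
qed simp

text \<open>Chain rule in t. Since \<open>x\<close> has no constant term in h, only the powers up to
  \<open>x ^ n\<close> reach the coefficient of h^n, so differentiation term by term is a finite
  computation.\<close>

lemma deriv_t_lift_compose:
  fixes F :: "'a::idom fps"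
  assumes "x $ 0 = 0"
  shows "deriv_t (lift F oo x) = (lift (fps_deriv F) oo x) * deriv_t x"
proof (rule fps_ext)
  fix n
  have hi: "x ^ i $ m = 0" if "m < i" for i m
    using startsby_zero_power_prefix[OF assms] that by simp
  have "deriv_t (lift F oo x) $ n = (\<Sum>i=0..n. fps_const (F $ i) * deriv_t (x ^ i) $ n)"
    by (simp add: fps_compose_nth fps_deriv_sum)
  \<comment> \<open>The added term vanishes, as \<open>x ^ Suc n\<close> has order above
    \<open>n\<close>; it makes room for the index shift.\<close>
  also have "\<dots> = (\<Sum>i=0..Suc n. fps_const (F $ i) * deriv_t (x ^ i) $ n)"
    by (simp add: hi del: power_Suc deriv_t_mult)
  also have "\<dots> = (\<Sum>i=0..n. fps_const (F $ Suc i) * deriv_t (x ^ Suc i) $ n)"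
    by (subst sum.atLeast0_atMost_Suc_shift) (simp del: power_Suc deriv_t_mult)
  also have "\<dots> = (\<Sum>i=0..n. fps_const (F $ Suc i) * (of_nat (Suc i) * (x ^ i * deriv_t x)) $ n)"
    unfolding deriv_t_power by (simp only: diff_Suc_1 mult.assoc)
  also have "\<dots> = (\<Sum>i=0..n. fps_const (fps_deriv F $ i) * (x ^ i * deriv_t x) $ n)"
  proof (intro sum.cong refl)
    fix i
    have "of_nat (Suc i) = (fps_const (fps_const (of_nat (Suc i))) :: 'a fps fps)"
      by (simp flip: fps_of_nat)
    then show "fps_const (F $ Suc i) * (of_nat (Suc i) * (x ^ i * deriv_t x)) $ n
        = fps_const (fps_deriv F $ i) * (x ^ i * deriv_t x) $ n"
      by (simp only: fps_mult_left_const_nth fps_deriv_nth flip: fps_const_mult) (simp add: ac_simps)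
  qed
  also have "\<dots> = (\<Sum>i=0..n. \<Sum>m=0..n. fps_const (fps_deriv F $ i) * x ^ i $ m * deriv_t x $ (n - m))"
    by (simp add: fps_mult_nth sum_distrib_left mult.assoc)
  also have "\<dots> = (\<Sum>m=0..n. \<Sum>i=0..n. fps_const (fps_deriv F $ i) * x ^ i $ m * deriv_t x $ (n - m))"
    by (rule sum.swap)
  also have "\<dots> = (\<Sum>m=0..n. (\<Sum>i=0..m. fps_const (fps_deriv F $ i) * x ^ i $ m) * deriv_t x $ (n - m))"
    unfolding sum_distrib_right
    by (intro sum.cong refl sum.mono_neutral_right) (auto simp: hi)
  also have "\<dots> = ((lift (fps_deriv F) oo x) * deriv_t x) $ n"
    unfolding fps_mult_nth fps_compose_nth fps_map_nth ..
  finally show "deriv_t (lift F oo x) $ n = ((lift (fps_deriv F) oo x) * deriv_t x) $ n" .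
qed

section \<open>Uniqueness for the differential equation\<close>

text \<open>Twice the difference of the two equations rearranges to
  \<open>deriv_t (d * T) = 4 * fps_X\<^sup>2 * d\<close>. As \<open>T\<close> has order exactly 1 in
  h, this forces the coefficients of \<open>d\<close> to vanish one after another.\<close>

lemma ode_unique:
  fixes Y Z :: "'a::{idom,ring_char_0} fps fps"
  assumes Y: "deriv_t Y * (fps_X + fps_X\<^sup>2 * fps_const fps_X - Y) = fps_X\<^sup>2 * (1 + Y)"
    and Z: "deriv_t Z * (fps_X + fps_X\<^sup>2 * fps_const fps_X - Z) = fps_X\<^sup>2 * (1 + Z)"
    and Y0: "Y $ 0 = 0" "at_0 Y = 0" and Z0: "Z $ 0 = 0" "at_0 Z = 0"
  shows "Y = Z"
proof -
  define d where "d = Y - Z"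
  define T where "T = 2 * fps_X + 2 * fps_X\<^sup>2 * fps_const fps_X - (Y + Z)"
  have at0: "Y $ i $ 0 = 0" "Z $ i $ 0 = 0" for i
    using arg_cong[OF Y0(2), of "\<lambda>F. F $ i"] arg_cong[OF Z0(2), of "\<lambda>F. F $ i"] by simp_all
  have two: "deriv_t (2 :: 'a fps fps) = 0"
    using deriv_t_fps_const[of "2 :: 'a fps"] by (simp add: numeral_fps_const)
  have ode: "deriv_t (d * T) = 4 * fps_X\<^sup>2 * d"
  proof -
    have "deriv_t (d * T) = 2 * (deriv_t Y * (fps_X + fps_X\<^sup>2 * fps_const fps_X - Y))
        - 2 * (deriv_t Z * (fps_X + fps_X\<^sup>2 * fps_const fps_X - Z)) + 2 * fps_X\<^sup>2 * d"
      by (simp add: d_def T_def two algebra_simps power2_eq_square)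
    then show ?thesis unfolding Y Z by (simp add: d_def algebra_simps)
  qed
  have T: "T $ 0 = 0" "T $ 1 $ 0 = 2"
    using Y0 Z0 by (simp_all add: T_def at0 power2_eq_square mult.assoc fps_numeral_nth)
  have "d $ n = 0" for n
  proof (induction n rule: less_induct)
    case (less n)
    have "(d * T) $ Suc n = (\<Sum>i=0..Suc n. d $ i * T $ (Suc n - i))"
      by (simp add: fps_mult_nth)
    also have "\<dots> = (\<Sum>i\<in>{n}. d $ i * T $ (Suc n - i))"
    proof (rule sum.mono_neutral_right)
      show "\<forall>i\<in>{0..Suc n} - {n}. d $ i * T $ (Suc n - i) = 0"
        using less T by (auto simp: le_Suc_eq order_le_less)
    qed auto
    finally have dT: "(d * T) $ Suc n = d $ n * T $ 1" by simp
    \<comment> \<open>By induction the right-hand side is 0 at this order, so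
      \<open>d $ n * T $ 1\<close> is constant in t, and its value at t = 0 is 0.\<close>
    have "fps_deriv (d $ n * T $ 1) = (4 * fps_X\<^sup>2 * d) $ Suc n"
      using arg_cong[OF ode, of "\<lambda>F. F $ Suc n"] unfolding fps_map_nth dT .
    also have "4 * fps_X\<^sup>2 * d = fps_X * (fps_X * (4 * d))"
      by (simp add: power2_eq_square ac_simps)
    also have "\<dots> $ Suc n = 0"
      using less by (cases n) (simp_all add: numeral_fps_const)
    finally have "d $ n * T $ 1 = fps_const ((d $ n * T $ 1) $ 0)"
      by (simp only: fps_deriv_eq_0_iff)
    also have "(d $ n * T $ 1) $ 0 = 0" using at0 by (simp add: d_def)
    finally have "d $ n * T $ 1 = 0" by simp
    moreover have "T $ 1 \<noteq> 0" using T(2) by (metis fps_zero_nth zero_neq_numeral)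
    ultimately show ?case by simp
  qed
  then have "d = 0" by (simp add: fps_eq_iff)
  then show ?thesis by (simp add: d_def)
qed

section \<open>Laurent polynomials in \<open>u\<close>\<close>

text \<open>Power series form no field, so the law is stated for units. One further factor
  \<open>f\<close> is the basic case, and induction on \<open>j\<close> in both directions does the
  rest.\<close>

lemma fps_power_int_add:
  fixes f :: "'a::field fps"
  assumes "f $ 0 \<noteq> 0"
  shows "f powi (i + j) = f powi i * f powi j"
proof -
  have unit: "f * inverse f = 1"
    using assms by (rule inverse_mult_eq_1')
  have "f \<noteq> 0" using assms by auto
  have succ: "f powi (m + 1) = f powi m * f" for m
  proof (cases "m \<ge> 0")
    case True
    then have "nat (m + 1) = Suc (nat m)" by simp
    with True show ?thesis by (simp add: power_int_def)
  next
    case False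
    then have "nat (- m) = Suc (nat (- (m + 1)))" by simp
    then have "f powi m * f = inverse f ^ nat (- (m + 1)) * (f * inverse f)"
      using False by (simp add: power_int_def ac_simps)
    with False show ?thesis by (simp add: unit) (auto simp: power_int_def)
  qed
  show ?thesis
  proof (induction j rule: int_induct[of _ 0])
    case (step1 j)
    then show ?case using succ[of "i + j"] succ[of j] by (simp add: ac_simps)
  next
    case (step2 j)
    have "f powi (i + (j - 1)) * f = f powi i * f powi (j - 1) * f"
      using step2 succ[of "i + (j - 1)"] succ[of "j - 1"] by (auto simp: ac_simps)
    with \<open>f \<noteq> 0\<close> show ?case by (metis mult_cancel_right)
  qed simp
qed

text \<open>The rational span of the powers of u with exponent in \<open>A\<close>. Rule induction
  on it replaces calculations with finitely supported maps until the very end.\<close>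

inductive_set laurent_span :: "int set \<Rightarrow> rat fps set" for A where
  zero: "0 \<in> laurent_span A"
| step: "f \<in> laurent_span A \<Longrightarrow> i \<in> A \<Longrightarrow> fps_const c * u_fps powi i + f \<in> laurent_span A"

lemma laurent_span_powi: "i \<in> A \<Longrightarrow> u_fps powi i \<in> laurent_span A"
  using laurent_span.step[OF laurent_span.zero, of i A 1] by simp

lemma laurent_span_add:
  "f \<in> laurent_span A \<Longrightarrow> g \<in> laurent_span A \<Longrightarrow> f + g \<in> laurent_span A"
  by (induction f rule: laurent_span.induct) (simp_all add: laurent_span.step add.assoc)

lemma laurent_span_scale: "f \<in> laurent_span A \<Longrightarrow> fps_const c * f \<in> laurent_span A"
proof (induction f rule: laurent_span.induct)
  case (step f i b)
  from laurent_span.step[OF step.IH step.hyps(2), of "c * b"]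
  show ?case by (simp add: distrib_left flip: mult.assoc)
qed (simp add: laurent_span.zero)

lemma laurent_span_const: "0 \<in> A \<Longrightarrow> fps_const c \<in> laurent_span A"
  using laurent_span_scale[OF laurent_span_powi[of 0 A], of c] by simp

lemma laurent_span_sum: "(\<And>x. x \<in> I \<Longrightarrow> f x \<in> laurent_span A) \<Longrightarrow> sum f I \<in> laurent_span A"
  by (induction I rule: infinite_finite_induct) (simp_all add: laurent_span.zero laurent_span_add)

lemma laurent_span_mult:
  assumes "f \<in> laurent_span A" "g \<in> laurent_span B"
    and AB: "\<And>i j. i \<in> A \<Longrightarrow> j \<in> B \<Longrightarrow> i + j \<in> C"
  shows "f * g \<in> laurent_span C"
  using assms(1)
proof (induction f rule: laurent_span.induct)
  case (step f i c)
  have "u_fps powi i * g \<in> laurent_span C"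
    using assms(2)
  proof (induction g rule: laurent_span.induct)
    case (step g j b)
    from laurent_span.step[OF step.IH AB[OF \<open>i \<in> A\<close> step.hyps(2)], of b]
    show ?case
      by (simp add: fps_power_int_add u_fps_nth_0 algebra_simps)
  qed (simp add: laurent_span.zero)
  from laurent_span_add[OF laurent_span_scale[OF this, of c] step.IH]
  show ?case by (simp add: algebra_simps)
qed (simp add: laurent_span.zero)

lemma laurent_span_mono: "f \<in> laurent_span A \<Longrightarrow> A \<subseteq> B \<Longrightarrow> f \<in> laurent_span B"
  by (induction f rule: laurent_span.induct) (auto intro: laurent_span.intros)

lemma laurent_eval_add: "laurent_eval (P + Q) f = laurent_eval P f + laurent_eval Q f"
proof -
  \<comment> \<open>Keys may cancel in \<open>P + Q\<close>, so all three sums are first extended to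
    one finite index set.\<close>
  have sup: "laurent_eval R f = (\<Sum>i\<in>I. fps_const (Poly_Mapping.lookup R i) * f powi i)"
    if "finite I" "Poly_Mapping.keys R \<subseteq> I" for R I
    unfolding laurent_eval_def using that
    by (intro sum.mono_neutral_left) (auto simp: in_keys_iff)
  define I where "I = Poly_Mapping.keys P \<union> Poly_Mapping.keys Q"
  have "finite I" by (simp add: I_def)
  moreover have "Poly_Mapping.keys (P + Q) \<subseteq> I"
    unfolding I_def by (rule Poly_Mapping.keys_add)
  ultimately show ?thesis
    using sup[of I P] sup[of I Q] sup[of I "P + Q"]
    by (simp add: I_def lookup_add sum.distrib distrib_right flip: fps_const_add)
qed

lemma laurent_eval_single: "laurent_eval (Poly_Mapping.single i c) f = fps_const c * f powi i"
  by (simp add: laurent_eval_def)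

lemma laurent_span_imp_laurent_eval:
  "f \<in> laurent_span A \<Longrightarrow> \<exists>M. f = laurent_eval M u_fps \<and> Poly_Mapping.keys M \<subseteq> A"
proof (induction f rule: laurent_span.induct)
  case zero
  have "0 = laurent_eval 0 u_fps" by (simp add: laurent_eval_def)
  then show ?case by (intro exI[of _ 0]) simp
next
  case (step f i c)
  then obtain M where M: "f = laurent_eval M u_fps" "Poly_Mapping.keys M \<subseteq> A" by blast
  have "Poly_Mapping.keys (Poly_Mapping.single i c + M) \<subseteq> A"
    using Poly_Mapping.keys_add[of "Poly_Mapping.single i c" M] M(2) \<open>i \<in> A\<close>
    by (auto split: if_splits)
  with M(1) show ?case
    by (intro exI[of _ "Poly_Mapping.single i c + M"])
      (simp add: laurent_eval_add laurent_eval_single)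
qed

text \<open>Makes the span of \<open>A\<close> a ring, so that products and substitutions of series
  in h keep their coefficients in it. The final set of exponents is not closed under addition, as
  (-1) + (-1) = -2 shows; hence even and odd powers of x are treated apart.\<close>

locale laurent_subalgebra =
  fixes A :: "int set"
  assumes zero_mem: "0 \<in> A"
    and add_mem: "i \<in> A \<Longrightarrow> j \<in> A \<Longrightarrow> i + j \<in> A"
begin

lemma coeff_lift: "lift F $ n \<in> laurent_span A"
  using laurent_span_const[OF zero_mem] by simp

lemma coeff_mult:
  assumes "\<And>n. F $ n \<in> laurent_span A" "\<And>n. G $ n \<in> laurent_span A"
  shows "(F * G) $ n \<in> laurent_span A"
  unfolding fps_mult_nth using assms
  by (intro laurent_span_sum laurent_span_mult[where C = A]) (auto intro: add_mem)

lemma coeff_power: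
  assumes "\<And>n. F $ n \<in> laurent_span A"
  shows "(F ^ i) $ n \<in> laurent_span A"
proof (induction i arbitrary: n)
  case 0
  show ?case using laurent_span_const[OF zero_mem, of 1] by (simp add: laurent_span.zero)
next
  case (Suc i)
  then show ?case using coeff_mult[OF assms] by simp
qed

lemma coeff_lift_compose:
  assumes "\<And>n. x $ n \<in> laurent_span A"
  shows "(lift F oo x) $ n \<in> laurent_span A"
  unfolding fps_compose_nth fps_map_nth
  by (intro laurent_span_sum laurent_span_scale coeff_power assms)

end

interpretation even_nonneg: laurent_subalgebra "{i. even i \<and> i \<ge> 0}"
  by standard auto

interpretation even: laurent_subalgebra "{i. even i}"
  by standard auto

section \<open>The differential equation for the generating function of the \<open>\<mu>\<^sub>l\<close>\<close>

interpretation pCons_hom: comm_ring_hom "\<lambda>c::'a::comm_ring_1. [:c:]"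
  by standard (simp_all add: one_pCons)

lemma deriv_log1p_fps: "(1 + fps_X) * fps_deriv log1p_fps = 1"
proof -
  have "fps_deriv log1p_fps = fps_map (\<lambda>c. [:c:]) (fps_deriv (fps_ln 1))"
    by (simp add: fps_eq_iff log1p_fps_def of_nat_poly)
  moreover have "1 + fps_X = fps_map (\<lambda>c::rat. [:c:]) (1 + fps_X)"
    by (simp add: pCons_hom.fps_map_add pCons_hom.fps_map_one pCons_hom.fps_map_fps_X)
  ultimately have "(1 + fps_X) * fps_deriv log1p_fps
      = fps_map (\<lambda>c::rat. [:c:]) ((1 + fps_X) * inverse (1 + fps_X))"
    by (simp add: pCons_hom.fps_map_mult fps_ln_deriv)
  also have "(1 + fps_X) * inverse (1 + fps_X :: rat fps) = 1"
    by (rule inverse_mult_eq_1') simp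
  finally show ?thesis by (simp add: pCons_hom.fps_map_one)
qed

lemma chi_nth_0: "chi $ 0 = 0"
  using is_chi_chi by (simp add: is_chi_def)

text \<open>Differentiating the defining equation in t gives k chi' log (1 + chi) = chi' - 1; after
  multiplication by 1 + chi the defining equation itself removes the logarithm.\<close>

lemma chi_ode: "fps_deriv chi * (1 + fps_X - k_fps * chi) = 1 + chi"
proof -
  define L where "L = log1p_fps oo chi"
  have eq: "k_fps * (1 + chi) * L = (k_fps + 1) * chi - fps_X"
    using is_chi_chi by (simp add: is_chi_def L_def)
  have "(1 + chi) * (fps_deriv log1p_fps oo chi) = ((1 + fps_X) * fps_deriv log1p_fps) oo chi"
    by (simp add: fps_compose_mult_distrib fps_compose_add_distrib chi_nth_0)
  then have dL: "(1 + chi) * fps_deriv L = fps_deriv chi"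
    by (simp add: L_def fps_compose_deriv chi_nth_0 deriv_log1p_fps flip: mult.assoc)
  have dk: "fps_deriv k_fps = 0"
    by (simp add: k_fps_def)
  have "k_fps * fps_deriv chi * L + k_fps * ((1 + chi) * fps_deriv L)
      = (k_fps + 1) * fps_deriv chi - 1"
    using arg_cong[OF eq, of fps_deriv] by (simp add: dk algebra_simps)
  then have "k_fps * fps_deriv chi * L = fps_deriv chi - 1"
    unfolding dL by (simp add: algebra_simps)
  then have "fps_deriv chi * (k_fps * (1 + chi) * L) = (fps_deriv chi - 1) * (1 + chi)"
    by (simp add: ac_simps)
  then show ?thesis
    unfolding eq by (simp add: algebra_simps)
qed

text \<open>The coefficient of t^m in \<open>chi_ode\<close> expresses \<open>chi $ Suc m\<close> by
  earlier ones. In the convolution the degrees i and m - i - 1 add up to m - 1, and the factor k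
  raises this to m.\<close>

lemma degree_chi: "degree (chi $ n) \<le> n - 1"
proof (induction n rule: less_induct)
  case (less n)
  show ?case
  proof (cases n)
    case 0
    then show ?thesis by (simp add: chi_nth_0)
  next
    case (Suc m)
    define Q where "Q = (\<Sum>i=0..m. of_nat (Suc i) * chi $ Suc i * chi $ (m - i))"
    have "fps_deriv chi = 1 + chi - fps_X * fps_deriv chi + k_fps * (fps_deriv chi * chi)"
      using chi_ode by (simp add: algebra_simps)
    from arg_cong[OF this, of "\<lambda>F. F $ m"]
    have "fps_deriv chi $ m
        = 1 $ m + chi $ m - (fps_X * fps_deriv chi) $ m + [:0, 1:] * (fps_deriv chi * chi) $ m"
      by (simp only: k_fps_def fps_add_nth fps_sub_nth fps_mult_left_const_nth)
    moreover have "(fps_deriv chi * chi) $ m = Q"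
      by (simp add: fps_mult_nth Q_def)
    moreover have "(fps_X * fps_deriv chi) $ m = of_nat m * chi $ m"
      by (cases m) simp_all
    ultimately    have eq: "of_nat (Suc m) * chi $ Suc m
        = 1 $ m + chi $ m - of_nat m * chi $ m + [:0, 1:] * Q"
      by simp
    have deg_of_nat: "degree (of_nat c * p) \<le> degree p" for c and p :: "rat poly"
      by (simp add: of_nat_poly degree_smult_le)
    have chi_m: "degree (chi $ m) \<le> m"
      using less[of m] Suc by simp
    \<comment> \<open>The case m = 0 stands apart: \<open>m - 1\<close> would be truncated to 0 and
      the factor k would give degree 1, but then \<open>Q\<close> is 0.\<close>
    have Q: "coeff ([:0, 1:] * Q) j = 0" if "j > m" for j
    proof (cases m)
      case 0
      then show ?thesis by (simp add: Q_def chi_nth_0)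
    next
      case (Suc m')
      have "degree Q \<le> m'"
        unfolding Q_def
      proof (rule degree_sum_le)
        fix i assume i: "i \<in> {0..m}"
        show "degree (of_nat (Suc i) * chi $ Suc i * chi $ (m - i)) \<le> m'"
        \<comment> \<open>The top term contains the coefficient \<open>chi $ Suc m\<close> under
          study, but its other factor \<open>chi $ 0\<close> is 0.\<close>
        proof (cases "i = m")
          case True
          then show ?thesis by (simp add: chi_nth_0)
        next
          case False
          with i have "i < m" by simp
          have "degree (of_nat (Suc i) * chi $ Suc i) \<le> i"
            using order.trans[OF deg_of_nat less[of "Suc i"]] \<open>i < m\<close> \<open>n = Suc m\<close>
            by (simp del: of_nat_Suc)
          moreover have "degree (chi $ (m - i)) \<le> m - i - 1"
            using less[of "m - i"] \<open>n = Suc m\<close> by simp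
          ultimately show ?thesis
            using degree_mult_le[of "of_nat (Suc i) * chi $ Suc i" "chi $ (m - i)"] \<open>i < m\<close> Suc
            by linarith
        qed
      qed simp
      with that Suc show ?thesis
        by (cases j) (simp_all add: coeff_pCons coeff_eq_0)
    qed
    have "coeff (chi $ Suc m) j = 0" if "j > m" for j
    proof -
      have "coeff (of_nat m * chi $ m) j = 0" "coeff (chi $ m) j = 0"
        using chi_m deg_of_nat[of m "chi $ m"] that by (auto intro: coeff_eq_0)
      moreover have "coeff ((1 :: rat poly fps) $ m) j = 0"
        using that by (cases m) simp_all
      ultimately have "coeff (of_nat (Suc m) * chi $ Suc m) j = 0"
        unfolding eq using Q[OF that] by simp
      then show ?thesis by (simp add: of_nat_poly del: of_nat_Suc)
    qed
    then show ?thesis using Suc by (simp add: degree_le)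
  qed
qed

text \<open>The coefficient of h^j in h^m p(1 / h). Reversal is relative to a prescribed
  \<open>m\<close> instead of the actual degree, so that it is additive in \<open>p\<close>.\<close>

definition rev_coeff :: "'a::zero poly \<Rightarrow> nat \<Rightarrow> nat \<Rightarrow> 'a" where
  "rev_coeff p m j = (if j \<le> m then coeff p (m - j) else 0)"

text \<open>Multiplies h^m p(1 / h) by h^m' q(1 / h); the degree bounds ensure that no term is cut
  off.\<close>

lemma rev_coeff_mult:
  fixes p q :: "'a::comm_semiring_0 poly"
  assumes "degree p \<le> m" "degree q \<le> m'"
  shows "rev_coeff (p * q) (m + m') l = (\<Sum>j=0..l. rev_coeff p m j * rev_coeff q m' (l - j))"
proof (cases "l \<le> m + m'")
  case True
  define N where "N = m + m' - l"
  have "(\<Sum>j=0..l. rev_coeff p m j * rev_coeff q m' (l - j))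
      = (\<Sum>j | j \<le> l \<and> j \<le> m \<and> l - j \<le> m'. rev_coeff p m j * rev_coeff q m' (l - j))"
    by (intro sum.mono_neutral_right) (auto simp: rev_coeff_def)
  also have "\<dots> = (\<Sum>i | i \<le> N \<and> i \<le> m \<and> N - i \<le> m'. coeff p i * coeff q (N - i))"
  proof (intro sum.reindex_bij_witness[where i = "\<lambda>i. m - i" and j = "\<lambda>j. m - j"])
    fix j assume "j \<in> {j. j \<le> l \<and> j \<le> m \<and> l - j \<le> m'}"
    then show "coeff p (m - j) * coeff q (N - (m - j)) = rev_coeff p m j * rev_coeff q m' (l - j)"
      using True by (auto simp: rev_coeff_def N_def intro!: arg_cong2[where f = "(*)"] arg_cong[where f = "coeff q"])
  qed (use True in \<open>auto simp: N_def\<close>)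
  also have "\<dots> = (\<Sum>i\<le>N. coeff p i * coeff q (N - i))"
  proof (rule sum.mono_neutral_left)
    have "i \<le> m \<and> N - i \<le> m'" if "coeff p i * coeff q (N - i) \<noteq> 0" for i
      using assms that by (metis le_degree mult_zero_left mult_zero_right order.trans)
    then show "\<forall>i\<in>{..N} - {i. i \<le> N \<and> i \<le> m \<and> N - i \<le> m'}. coeff p i * coeff q (N - i) = 0"
      by blast
  qed auto
  also have "\<dots> = rev_coeff (p * q) (m + m') l"
    using True by (simp add: rev_coeff_def coeff_mult N_def)
  finally show ?thesis ..
next
  case False
  then have "rev_coeff p m j * rev_coeff q m' (l - j) = 0" for j
    by (auto simp: rev_coeff_def)
  with False show ?thesis by (simp add: rev_coeff_def)
qed

text \<open>If \<open>F\<close> stands for \<open>F(t, k)\<close>, then \<open>rev_fps w F\<close> is \<open>h\<^sup>w F(h t, 1 / h)\<close>.\<close>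

definition rev_fps :: "nat \<Rightarrow> 'a::zero poly fps \<Rightarrow> 'a fps fps" where
  "rev_fps w F = Abs_fps (\<lambda>l. Abs_fps (\<lambda>n. rev_coeff (F $ n) (n + w) l))"

lemma rev_coeff_sum: "rev_coeff (sum f I) m l = (\<Sum>i\<in>I. rev_coeff (f i) m l)"
  by (simp add: rev_coeff_def coeff_sum)

lemma rev_fps_mult:
  fixes F G :: "'a::comm_ring_1 poly fps"
  assumes "\<And>n. degree (F $ n) \<le> n + v" "\<And>n. degree (G $ n) \<le> n + w"
  shows "rev_fps (v + w) (F * G) = rev_fps v F * rev_fps w G"
proof (intro fps_ext)
  fix l n
  have "rev_fps (v + w) (F * G) $ l $ n
      = (\<Sum>i=0..n. rev_coeff (F $ i * G $ (n - i)) ((i + v) + (n - i + w)) l)"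
    unfolding rev_fps_def fps_nth_Abs_fps fps_mult_nth rev_coeff_sum
    by (intro sum.cong) (auto intro!: arg_cong2[where f = "rev_coeff _"])
  also have "\<dots> = (\<Sum>i=0..n. \<Sum>j=0..l.
      rev_coeff (F $ i) (i + v) j * rev_coeff (G $ (n - i)) (n - i + w) (l - j))"
    by (simp add: rev_coeff_mult assms del: add_diff_assoc add_diff_assoc2)
  also have "\<dots> = (\<Sum>j=0..l. \<Sum>i=0..n.
      rev_coeff (F $ i) (i + v) j * rev_coeff (G $ (n - i)) (n - i + w) (l - j))"
    by (rule sum.swap)
  also have "\<dots> = (rev_fps v F * rev_fps w G) $ l $ n"
    by (simp add: fps_mult_nth fps_sum_nth rev_fps_def)
  finally show "rev_fps (v + w) (F * G) $ l $ n = (rev_fps v F * rev_fps w G) $ l $ n" .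
qed

lemma rev_fps_add: "rev_fps w (F + G) = rev_fps w F + rev_fps w G"
  for F G :: "'a::comm_ring_1 poly fps"
  by (simp add: fps_eq_iff rev_fps_def rev_coeff_def)

lemma rev_fps_diff: "rev_fps w (F - G) = rev_fps w F - rev_fps w G"
  for F G :: "'a::comm_ring_1 poly fps"
  by (simp add: fps_eq_iff rev_fps_def rev_coeff_def)

lemma rev_fps_one: "rev_fps w 1 = (fps_X ^ w :: 'a::comm_ring_1 fps fps)"
proof (intro fps_ext)
  fix l n
  show "rev_fps w (1 :: 'a poly fps) $ l $ n = fps_X ^ w $ l $ n"
    by (cases n) (auto simp: rev_fps_def rev_coeff_def)
qed

lemma rev_fps_fps_X: "rev_fps 1 fps_X = (fps_X\<^sup>2 * fps_const fps_X :: 'a::comm_ring_1 fps fps)"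
  by (auto simp: fps_eq_iff rev_fps_def rev_coeff_def fps_X_power_mult_nth)

definition mu_gf :: "rat fps fps" where
  "mu_gf = Abs_fps mu_egf"

lemma mu_gf_eq: "mu_gf = rev_fps 0 chi"
  by (simp add: fps_eq_iff mu_gf_def mu_egf_def mu_def rev_fps_def rev_coeff_def)

text \<open>Substitutes into \<open>chi_ode\<close> and multiplies by h^2, one h for each factor on
  the left: the first turns the derivative at h t into a derivative in t, the second cancels the k
  in k chi.\<close>

lemma mu_gf_ode:
  "deriv_t mu_gf * (fps_X + fps_X\<^sup>2 * fps_const fps_X - mu_gf) = fps_X\<^sup>2 * (1 + mu_gf)"
proof -
  have deg: "degree (chi $ n) \<le> n" for n
    using degree_chi[of n] by simp
  have 1: "rev_fps 1 (fps_deriv chi) = deriv_t mu_gf"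
    by (auto simp: fps_eq_iff mu_gf_eq rev_fps_def rev_coeff_def of_nat_poly simp del: of_nat_Suc)
  have k: "rev_fps 1 (k_fps * chi) = mu_gf"
    by (auto simp: fps_eq_iff mu_gf_eq rev_fps_def rev_coeff_def k_fps_def le_Suc_eq Suc_diff_le coeff_pCons)
  have 2: "rev_fps 1 (1 + fps_X - k_fps * chi) = fps_X + fps_X\<^sup>2 * fps_const fps_X - mu_gf"
    by (simp add: rev_fps_diff rev_fps_add rev_fps_one rev_fps_fps_X[simplified] k[simplified])
  \<comment> \<open>Raising the weight just multiplies by h^2 because \<open>chi $ n\<close> has no
    coefficients above \<open>n\<close>.\<close>
  have 3: "rev_fps 2 chi = fps_X\<^sup>2 * mu_gf"
    using coeff_eq_0[OF le_less_trans[OF deg]]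
    by (auto simp: fps_eq_iff mu_gf_eq rev_fps_def rev_coeff_def fps_X_power_mult_nth)
  have "rev_fps (1 + 1) (fps_deriv chi * (1 + fps_X - k_fps * chi))
      = deriv_t mu_gf * (fps_X + fps_X\<^sup>2 * fps_const fps_X - mu_gf)"
    unfolding 1[symmetric] 2[symmetric]
  proof (rule rev_fps_mult)
    fix n
    show "degree (fps_deriv chi $ n) \<le> n + 1"
      using deg[of "Suc n"] by (simp add: of_nat_poly order.trans[OF degree_smult_le] del: of_nat_Suc)
    have "degree ([:0, 1:] * chi $ n) \<le> n + 1"
      using degree_mult_le[of "[:0, 1:]" "chi $ n"] deg[of n] by simp
    moreover have "degree ((1 + fps_X :: rat poly fps) $ n) \<le> n + 1"
      by (simp add: fps_X_def)
    ultimately show "degree ((1 + fps_X - k_fps * chi) $ n) \<le> n + 1"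
      by (simp add: k_fps_def degree_diff_le del: mult_pCons_left)
  qed
  moreover have "rev_fps (1 + 1) (1 + chi) = fps_X\<^sup>2 * (1 + mu_gf)"
    using 3 by (simp add: rev_fps_add rev_fps_one distrib_left numeral_2_eq_2)
  ultimately show ?thesis
    using chi_ode by simp
qed

text \<open>The coefficient of h^0 collects the k^n in \<open>chi $ n\<close>, excluded by the
  degree bound; at t = 0 only \<open>chi $ 0\<close> remains.\<close>

lemma mu_gf_initial: "mu_gf $ 0 = 0" "at_0 mu_gf = 0"
proof -
  have "coeff (chi $ n) n = 0" for n
    using degree_chi[of n] by (cases n) (simp_all add: chi_nth_0 coeff_eq_0)
  then show "mu_gf $ 0 = 0"
    by (simp add: fps_eq_iff mu_gf_eq rev_fps_def rev_coeff_def)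
  show "at_0 mu_gf = 0"
    by (simp add: fps_eq_iff mu_gf_eq rev_fps_def rev_coeff_def chi_nth_0)
qed

section \<open>Explicit solution\<close>

lemma lift_compose_mult:
  fixes F G :: "'a::idom fps"
  shows "x $ 0 = 0 \<Longrightarrow> lift (F * G) oo x = (lift F oo x) * (lift G oo x)"
  by (simp add: fps_const_hom.fps_map_mult fps_compose_mult_distrib)

lemma fps_binomial_half_square: "fps_binomial (1/2) * fps_binomial (1/2) = (1 + fps_X :: rat fps)"
  by (simp add: fps_binomial_1 flip: fps_binomial_add_mult)

text \<open>With \<open>H(x) = 2 ((1 + x) log (1 + x) - x)\<close>, the series \<open>\<phi>\<close> is defined by \<open>H(\<phi>(x)) = x\<^sup>2\<close>.\<close>

lemma ex_uniformizer:
  obtains \<phi> x0 :: "rat fps"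
  where "\<phi> $ 0 = 0" "fps_deriv \<phi> * (2 * \<phi> + fps_X\<^sup>2) = 2 * fps_X * (1 + \<phi>)"
    "x0 $ 0 = 0" "x0 $ 1 = - 1" "x0\<^sup>2 = 2 - 2 * (1 + fps_X) * fps_exp (- 1)"
    "\<phi> oo x0 = fps_exp (- 1) - 1"
proof -
  define H :: "rat fps" where "H = 2 * ((1 + fps_X) * fps_ln 1 - fps_X)"
  have H_nth: "H $ 0 = 0" "H $ Suc 0 = 0" "H $ Suc (Suc 0) = 1"
    by (simp_all add: H_def fps_ln_nth distrib_right numeral_fps_const)
  define g where "g = fps_shift 2 H"
  have g: "H = fps_X\<^sup>2 * g"
  proof (rule fps_ext)
    fix n
    have "Suc (Suc (n - 2)) = n" if "\<not> n < 2"
      using that by simp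
    then show "H $ n = (fps_X\<^sup>2 * g) $ n"
      using H_nth by (auto simp: g_def fps_X_power_mult_nth numeral_fps_const dest!: less_2_cases)
  qed
  define c where "c = g - 1"
  have c0: "c $ 0 = 0"
    using H_nth by (simp add: c_def g_def numeral_2_eq_2 numeral_fps_const)
  \<comment> \<open>The square root of \<open>H\<close> with leading term x, namely x times the root
    of \<open>H\<close> / x^2 = 1 + \<open>c\<close>.\<close>
  define q where "q = fps_X * (fps_binomial (1/2) oo c)"
  have q_nth: "q $ 0 = 0" "q $ 1 = 1"
    by (simp_all add: q_def)
  have "(fps_binomial (1/2) oo c) * (fps_binomial (1/2) oo c) = 1 + c"
    by (simp add: fps_binomial_half_square fps_compose_add_distrib c0
        flip: fps_compose_mult_distrib)
  then have q_square: "q * q = H"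
    unfolding g q_def by (simp add: power2_eq_square ac_simps c_def)
  define \<phi> where "\<phi> = fps_inv q"
  have \<phi>0: "\<phi> $ 0 = 0"
    by (simp add: \<phi>_def fps_inv_def)
  have "H oo \<phi> = (q oo \<phi>) * (q oo \<phi>)"
    by (simp add: \<phi>0 fps_compose_mult_distrib flip: q_square)
  also have "q oo \<phi> = fps_X"
    unfolding \<phi>_def by (rule fps_inv_right) (simp_all add: q_nth[simplified])
  finally have H_\<phi>: "H oo \<phi> = fps_X\<^sup>2"
    by (simp add: power2_eq_square)
  have "(1 + fps_X) * inverse (1 + fps_X) = (1 :: rat fps)"
    by (rule inverse_mult_eq_1') simp
  then have "fps_deriv H = 2 * fps_ln 1"
    by (simp add: H_def fps_ln_deriv)
  \<comment> \<open>This combination is free of the logarithm; composed with \<phi> it yields the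
    differential equation.\<close>
  then have "(1 + fps_X) * fps_deriv H = H + 2 * fps_X"
    by (simp add: H_def algebra_simps)
  then have "((1 + fps_X) * fps_deriv H) oo \<phi> = (H + 2 * fps_X) oo \<phi>"
    by (rule arg_cong)
  then have H'_\<phi>: "(1 + \<phi>) * (fps_deriv H oo \<phi>) = fps_X\<^sup>2 + 2 * \<phi>"
    by (simp only: fps_compose_mult_distrib[OF \<phi>0] fps_compose_add_distrib H_\<phi>)
      (simp add: fps_compose_mult_distrib[OF \<phi>0] numeral_fps_const \<phi>0)
  have d\<phi>: "(fps_deriv H oo \<phi>) * fps_deriv \<phi> = 2 * fps_X"
    using arg_cong[OF H_\<phi>, of fps_deriv] by (simp add: fps_compose_deriv \<phi>0 power2_eq_square)
  have "fps_deriv \<phi> * ((1 + \<phi>) * (fps_deriv H oo \<phi>)) = (fps_deriv H oo \<phi>) * fps_deriv \<phi> * (1 + \<phi>)"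
    by (simp only: ac_simps)
  then have ode: "fps_deriv \<phi> * (2 * \<phi> + fps_X\<^sup>2) = 2 * fps_X * (1 + \<phi>)"
    unfolding H'_\<phi> d\<phi> by (simp only: add.commute)
  \<comment> \<open>The value of S that corresponds to X = 0 in 1 + X = e^h (1 + S).\<close>
  define w :: "rat fps" where "w = fps_exp (- 1) - 1"
  have w_nth: "w $ 0 = 0" "w $ Suc 0 = - 1"
    by (simp_all add: w_def)
  have "(1 + w) * (inverse (1 + fps_X) oo w) = ((1 + fps_X) * inverse (1 + fps_X)) oo w"
    by (simp only: fps_compose_mult_distrib[OF w_nth(1)] fps_compose_add_distrib)
      (simp add: w_nth)
  also have "(1 + fps_X) * inverse (1 + fps_X) = (1 :: rat fps)"
    by (rule inverse_mult_eq_1') simp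
  finally have "fps_deriv (fps_ln 1 oo w) = - 1"
    by (simp add: fps_compose_deriv w_nth fps_ln_deriv) (simp add: w_def ac_simps)
  then have "fps_deriv (fps_ln 1 oo w) = fps_deriv (- fps_X)"
    by simp
  then have ln_w: "fps_ln 1 oo w = - fps_X"
    unfolding fps_deriv_eq_iff by simp
  \<comment> \<open>The root x at t = 0, with \<phi>(\<open>x0\<close>) = \<open>w\<close>; its sign
    is fixed by \<open>q\<close>.\<close>
  define x0 where "x0 = q oo w"
  have "x0\<^sup>2 = H oo w"
    by (simp add: x0_def power2_eq_square w_nth q_square flip: fps_compose_mult_distrib)
  also have "\<dots> = 2 * ((1 + w) * (- fps_X) - w)"
    by (simp add: H_def fps_compose_mult_distrib w_nth fps_compose_add_distrib
        fps_compose_sub_distrib ln_w numeral_fps_const)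
  also have "\<dots> = 2 - 2 * (1 + fps_X) * fps_exp (- 1)"
    by (simp add: w_def algebra_simps)
  finally have x0_square: "x0\<^sup>2 = 2 - 2 * (1 + fps_X) * fps_exp (- 1)" .
  have "\<phi> oo x0 = \<phi> oo q oo w"
    unfolding x0_def by (rule fps_compose_assoc) (simp_all add: w_nth q_nth[simplified])
  also have "\<phi> oo q = fps_X"
    unfolding \<phi>_def by (rule fps_inv) (simp_all add: q_nth[simplified])
  finally have \<phi>_x0: "\<phi> oo x0 = fps_exp (- 1) - 1"
    by (simp add: w_def)
  have "x0 $ 0 = 0" "x0 $ 1 = - 1"
    using q_nth w_nth by (simp_all add: x0_def fps_compose_nth)
  with that \<phi>0 ode x0_square \<phi>_x0 show thesis by blast
qed

text \<open>Builds x, S = \<phi>(x) and Z = e^h (1 + S) - 1 explicitly. The exponents are read off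
  from x^2 and from x / u, and \<open>Z\<close> shares the equation and the initial values of
  \<open>mu_gf\<close>.\<close>

lemma ex_laurent_solution:
  obtains Z :: "rat fps fps"
  where "Z $ 0 = 0" "at_0 Z = 0"
    "deriv_t Z * (fps_X + fps_X\<^sup>2 * fps_const fps_X - Z) = fps_X\<^sup>2 * (1 + Z)"
    "\<And>n. Z $ n \<in> laurent_span {i. 0 \<le> i \<or> odd i}"
proof -
  obtain \<phi> x0 :: "rat fps" where \<phi>0: "\<phi> $ 0 = 0"
    and \<phi>_ode: "fps_deriv \<phi> * (2 * \<phi> + fps_X\<^sup>2) = 2 * fps_X * (1 + \<phi>)"
    and x0_nth: "x0 $ 0 = 0" "x0 $ 1 = - 1"
    and x0_square: "x0\<^sup>2 = 2 - 2 * (1 + fps_X) * fps_exp (- 1)"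
    and \<phi>_x0: "\<phi> oo x0 = fps_exp (- 1) - 1"
    by (rule ex_uniformizer)

  \<comment> \<open>The root x and its square\<close>
  define r where "r = fps_shift 1 x0"
  have x0_r: "x0 = fps_X * r"
    using x0_nth by (simp add: fps_eq_iff r_def)
  define e e' :: "rat fps" where "e = fps_exp (- 1)" and "e' = fps_exp 1"
  have ee': "e * e' = 1"
    unfolding e_def e'_def by (simp flip: fps_exp_add_mult)
  \<comment> \<open>Chosen so that \<open>x0\<^sup>2 * B\<close> is h^2 e^(-h); this is a power
    series because \<open>x0\<close> is h times a unit.\<close>
  define B where "B = e * inverse (r\<^sup>2)"
  have r0: "r\<^sup>2 $ 0 = 1"
    using x0_nth by (simp add: r_def fps_power_zeroth)
  then have rB: "r\<^sup>2 * B = e"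
    using inverse_mult_eq_1'[of "r\<^sup>2"] by (simp add: B_def mult.left_commute)
  have B0: "B $ 0 = 1"
    by (simp add: B_def e_def r0)
  have x0B: "lift (x0\<^sup>2) * lift B = fps_X\<^sup>2 * lift e"
  proof -
    have "x0\<^sup>2 * B = fps_X\<^sup>2 * e"
      by (simp add: x0_r power_mult_distrib mult.assoc rB)
    from arg_cong[OF this, of lift] show ?thesis
      by (simp add: fps_const_hom.fps_map_mult fps_const_hom.fps_map_power fps_const_hom.fps_map_fps_X)
  qed
  \<comment> \<open>Since \<open>u\<^sup>2 (1 + y) = 1 - 2 t B\<close> and \<open>x0\<^sup>2 B = h\<^sup>2 e\<^sup>-\<^sup>h\<close>, this makes \<open>x = u x0 (1 + y)\<^sup>1\<^sup>/\<^sup>2\<close>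
    the required root, with value \<open>x0\<close> at \<open>t = 0\<close>.\<close>
  define y where "y = fps_const (1 - (inverse u_fps)\<^sup>2) * lift (B - 1)"
  have y0: "y $ 0 = 0"
    by (simp add: y_def B0)
  define v where "v = lift (fps_binomial (1/2)) oo y"
  have v_square: "v * v = 1 + y"
    unfolding v_def lift_compose_mult[OF y0, symmetric] fps_binomial_half_square
    by (simp add: fps_const_hom.fps_map_add fps_const_hom.fps_map_one
        fps_const_hom.fps_map_fps_X fps_compose_add_distrib y0)
  define x where "x = fps_const u_fps * (lift x0 * v)"
  have x_nth_0: "x $ 0 = 0"
    by (simp add: x_def x0_nth)
  have "u_fps * inverse u_fps = 1"
    by (rule inverse_mult_eq_1') (simp add: u_fps_nth_0)
  then have "u_fps\<^sup>2 * (inverse u_fps)\<^sup>2 = 1"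
    by (simp flip: power_mult_distrib)
  then have u_inv: "u_fps\<^sup>2 * (1 - (inverse u_fps)\<^sup>2) = - 2 * fps_X"
    unfolding right_diff_distrib by (simp add: u_fps_square)
  have "fps_const (u_fps\<^sup>2) * (1 + y) = fps_const (u_fps\<^sup>2) + fps_const (- 2 * fps_X) * lift (B - 1)"
    by (simp only: y_def distrib_left fps_const_mult u_inv flip: mult.assoc) simp
  also have "\<dots> = 1 - fps_const (2 * fps_X) * lift B"
    by (simp add: u_fps_square fps_const_hom.fps_map_diff fps_const_hom.fps_map_one
        algebra_simps flip: fps_const_sub fps_const_neg)
  finally have "fps_const (u_fps\<^sup>2) * (v * v) = 1 - fps_const (2 * fps_X) * lift B"
    unfolding v_square .
  moreover have "x\<^sup>2 = lift (x0\<^sup>2) * (fps_const (u_fps\<^sup>2) * (v * v))"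
    by (simp add: x_def power2_eq_square fps_const_hom.fps_map_mult ac_simps flip: fps_const_mult)
  \<comment> \<open>This factored form shows the exponents of u; the expanded form below is the one
    to differentiate.\<close>
  ultimately have x_square': "x\<^sup>2 = lift (x0\<^sup>2) * (1 - fps_const (2 * fps_X) * lift B)"
    by simp
  then have "x\<^sup>2 = lift (x0\<^sup>2) - fps_const (2 * fps_X) * (lift (x0\<^sup>2) * lift B)"
    by (simp add: algebra_simps)
  then have x_square: "x\<^sup>2 = lift (x0\<^sup>2) - fps_const (2 * fps_X) * (fps_X\<^sup>2 * lift e)"
    unfolding x0B .

  \<comment> \<open>The differential equations for S and Z\<close>
  define S where "S = lift \<phi> oo x"
  define P where "P = lift (fps_deriv \<phi>) oo x"
  \<comment> \<open>Doubling is written as a sum, so that additivity carries the identity through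
    \<open>lift\<close> and composition.\<close>
  have "fps_deriv \<phi> * (\<phi> + \<phi> + fps_X * fps_X) = (fps_X + fps_X) * (1 + \<phi>)"
    using \<phi>_ode by (simp add: power2_eq_square flip: mult_2)
  from arg_cong[OF this, of "\<lambda>F. lift F oo x"]
  have P: "P * (2 * S + x\<^sup>2) = 2 * x * (1 + S)"
    unfolding lift_compose_mult[OF x_nth_0] fps_const_hom.fps_map_add fps_compose_add_distrib
      fps_const_hom.fps_map_one fps_const_hom.fps_map_fps_X
    by (simp add: P_def S_def x_nth_0 power2_eq_square flip: mult_2)
  have dS: "deriv_t S = P * deriv_t x"
    unfolding S_def P_def by (rule deriv_t_lift_compose[OF x_nth_0])
  \<comment> \<open>The derivative of x enters only through that of x^2, which is explicit.\<close>
  have "2 * x * deriv_t x = - 2 * fps_X\<^sup>2 * lift e"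
    using arg_cong[OF x_square, of deriv_t]
    by (simp add: power2_eq_square ac_simps flip: numeral_fps_const mult_2)
  moreover have "deriv_t S * (2 * S + x\<^sup>2) = P * (2 * S + x\<^sup>2) * deriv_t x"
    by (simp add: dS ac_simps)
  then have "deriv_t S * (2 * S + x\<^sup>2) = 2 * x * deriv_t x * (1 + S)"
    unfolding P by (simp add: ac_simps)
  ultimately have S_ode: "deriv_t S * (2 * S + x\<^sup>2) = - 2 * fps_X\<^sup>2 * lift e * (1 + S)"
    by simp
  have "lift (x0\<^sup>2) = 2 - 2 * ((1 + fps_X) * lift e)"
  proof -
    have "x0\<^sup>2 = 1 + 1 - ((1 + fps_X) * e + (1 + fps_X) * e)"
      using x0_square by (simp add: e_def algebra_simps)
    then have "lift (x0\<^sup>2) = 1 + 1 - ((1 + fps_X) * lift e + (1 + fps_X) * lift e)"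
      by (simp only: fps_const_hom.fps_map_diff fps_const_hom.fps_map_add fps_const_hom.fps_map_mult
          fps_const_hom.fps_map_one fps_const_hom.fps_map_fps_X)
    then show ?thesis
      by (simp only: mult_2 one_add_one)
  qed
  then have x_square_e: "x\<^sup>2 = 2 - 2 * ((1 + fps_X + fps_X\<^sup>2 * fps_const fps_X) * lift e)"
    unfolding x_square by (simp add: algebra_simps flip: numeral_fps_const fps_const_mult)
  define Z where "Z = lift e' * (1 + S) - 1"
  have lift_ee': "lift e * lift e' = 1"
    using arg_cong[OF ee', of lift] by (simp add: fps_const_hom.fps_map_mult fps_const_hom.fps_map_one)
  have dZ: "deriv_t Z = lift e' * deriv_t S"
    by (simp add: Z_def)
  have "lift e' * (2 * S + x\<^sup>2) = 2 * (lift e' * (1 + S))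
      - 2 * (1 + fps_X + fps_X\<^sup>2 * fps_const fps_X) * (lift e * lift e')"
    unfolding x_square_e by (simp add: algebra_simps)
  \<comment> \<open>Undoing the shift of the critical point turns the factor 2 S + x^2 into a
    multiple of h + h^2 t - Z.\<close>
  then have Z2: "2 * (fps_X + fps_X\<^sup>2 * fps_const fps_X - Z) = - (lift e' * (2 * S + x\<^sup>2))"
    unfolding lift_ee' Z_def by (simp add: algebra_simps)
  have "2 * (deriv_t Z * (fps_X + fps_X\<^sup>2 * fps_const fps_X - Z))
      = deriv_t Z * (2 * (fps_X + fps_X\<^sup>2 * fps_const fps_X - Z))"
    by (simp add: ac_simps)
  also have "\<dots> = - (lift e' * lift e' * (deriv_t S * (2 * S + x\<^sup>2)))"
    unfolding Z2 dZ by (simp add: ac_simps)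
  also have "\<dots> = 2 * (fps_X\<^sup>2 * ((lift e * lift e') * (lift e' * (1 + S))))"
    unfolding S_ode by (simp add: ac_simps)
  also have "\<dots> = 2 * (fps_X\<^sup>2 * (1 + Z))"
    unfolding lift_ee' by (simp add: Z_def)
  finally have ode: "deriv_t Z * (fps_X + fps_X\<^sup>2 * fps_const fps_X - Z) = fps_X\<^sup>2 * (1 + Z)"
    by simp

  \<comment> \<open>Initial values\<close>
  have Z0: "Z $ 0 = 0"
    by (simp add: Z_def S_def \<phi>0 e'_def)
  \<comment> \<open>At t = 0 one has u = 1, hence y = 0, v = 1 and x = \<open>x0\<close>; there S =
    e^(-h) - 1 and Z = 0.\<close>
  have "at_0 y = 0"
    by (simp add: y_def fps_nth_0_hom.fps_map_mult fps_nth_0_hom.fps_map_fps_const u_fps_nth_0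
        fps_power_zeroth)
  then have "at_0 v = 1"
    by (simp add: v_def fps_nth_0_hom.fps_map_compose)
  then have "at_0 x = x0"
    by (simp add: x_def fps_nth_0_hom.fps_map_mult fps_nth_0_hom.fps_map_fps_const u_fps_nth_0)
  then have "at_0 S = e - 1"
    by (simp add: S_def fps_nth_0_hom.fps_map_compose \<phi>_x0 e_def)
  then have at_0_Z: "at_0 Z = 0"
    using ee' by (simp add: Z_def fps_nth_0_hom.fps_map_mult fps_nth_0_hom.fps_map_diff
        fps_nth_0_hom.fps_map_add fps_nth_0_hom.fps_map_one mult.commute)

  \<comment> \<open>Exponents of u\<close>
  have "(1 - fps_const (2 * fps_X) * lift B) $ n \<in> laurent_span {i. even i \<and> i \<ge> 0}" for n
  proof -
    \<comment> \<open>Here 2 t is replaced by 1 - u^2.\<close>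
    have "1 - fps_const (2 * fps_X) * lift B = lift (1 - B) + fps_const (u_fps\<^sup>2) * lift B"
      unfolding u_fps_square fps_const_hom.fps_map_diff fps_const_hom.fps_map_one
      by (simp add: algebra_simps flip: fps_const_sub)
    moreover have "u_fps powi 2 \<in> laurent_span {i. even i \<and> i \<ge> 0}"
      by (rule laurent_span_powi) simp
    then have "fps_const (B $ n) * u_fps\<^sup>2 \<in> laurent_span {i. even i \<and> i \<ge> 0}"
      using laurent_span_scale by simp
    ultimately show ?thesis
      using laurent_span_add even_nonneg.coeff_lift[of "1 - B" n] by (simp add: mult.commute)
  qed
  then have x_even: "((x\<^sup>2) ^ j) $ n \<in> laurent_span {i. even i \<and> i \<ge> 0}" for j n
    unfolding x_square' by (intro even_nonneg.coeff_power even_nonneg.coeff_mult even_nonneg.coeff_lift)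
  have "y $ n \<in> laurent_span {i. even i}" for n
  proof -
    have "u_fps powi (- 2) \<in> laurent_span {i. even i}"
      by (rule laurent_span_powi) simp
    then have "fps_const (- ((B - 1) $ n)) * (inverse u_fps)\<^sup>2 \<in> laurent_span {i. even i}"
      using laurent_span_scale by (simp add: power_int_def)
    from laurent_span_add[OF even.coeff_lift[of "B - 1" n] this] show ?thesis
      by (simp add: y_def algebra_simps flip: fps_const_neg fps_const_sub)
  qed
  then have v: "v $ n \<in> laurent_span {i. even i}" for n
    unfolding v_def by (rule even.coeff_lift_compose)
  \<comment> \<open>Even powers of x are powers of x^2. From an odd power one factor u is split off,
    and the rest has only even exponents, possibly negative.\<close>
  have x_power: "(x ^ i) $ n \<in> laurent_span {i. 0 \<le> i \<or> odd i}" for i n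
  proof (cases "even i")
    case True
    then obtain j where "i = 2 * j" by blast
    moreover have "((x\<^sup>2) ^ j) $ n \<in> laurent_span {i. 0 \<le> i \<or> odd i}"
      by (rule laurent_span_mono[OF x_even]) auto
    ultimately show ?thesis
      by (simp add: power_mult)
  next
    case False
    then obtain j where "i = 2 * j + 1" by (blast elim: oddE)
    then have "x ^ i = x * (x\<^sup>2) ^ j"
      by (simp add: power_mult)
    moreover have "x * z = fps_const u_fps * (lift x0 * v * z)" for z
      by (simp add: x_def mult.assoc)
    ultimately have x_odd: "x ^ i = fps_const u_fps * (lift x0 * v * (x\<^sup>2) ^ j)"
      by simp
    have "(lift x0 * v * (x\<^sup>2) ^ j) $ n \<in> laurent_span {i. even i}"
      by (intro even.coeff_mult even.coeff_lift v laurent_span_mono[OF x_even]) auto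
    moreover have "u_fps \<in> laurent_span {1}"
      using laurent_span_powi[of 1 "{1}"] by simp
    ultimately show ?thesis
      unfolding x_odd fps_mult_left_const_nth by (auto intro: laurent_span_mult)
  qed
  have "S $ n \<in> laurent_span {i. 0 \<le> i \<or> odd i}" for n
    unfolding S_def fps_compose_nth fps_map_nth
    by (intro laurent_span_sum laurent_span_scale x_power)
  then have S1: "(1 + S) $ n \<in> laurent_span {i. 0 \<le> i \<or> odd i}" for n
    using laurent_span_add[OF laurent_span_const[of _ "1 $ n"]] by (cases n) simp_all
  have "Z $ n \<in> laurent_span {i. 0 \<le> i \<or> odd i}" for n
  proof -
    have "(lift e' * (1 + S)) $ n \<in> laurent_span {i. 0 \<le> i \<or> odd i}"
      unfolding fps_mult_nth fps_map_nth by (intro laurent_span_sum laurent_span_scale S1)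
    from laurent_span_add[OF this laurent_span_const[of _ "- (1 $ n)"]]
    show ?thesis by (cases n) (simp_all add: Z_def flip: fps_const_neg)
  qed
  with that Z0 at_0_Z ode show thesis by blast
qed

theorem theorem1:
  fixes l :: nat
  assumes "l \<ge> 1"
  shows "\<exists>M :: int \<Rightarrow>\<^sub>0 rat.
           mu_egf l = laurent_eval M u_fps \<and>
           (\<forall>i < 0. Poly_Mapping.lookup M i \<noteq> 0 \<longrightarrow> odd i)"
proof -
  obtain Z :: "rat fps fps" where Z: "Z $ 0 = 0" "at_0 Z = 0"
      "deriv_t Z * (fps_X + fps_X\<^sup>2 * fps_const fps_X - Z) = fps_X\<^sup>2 * (1 + Z)"
    and span: "\<And>n. Z $ n \<in> laurent_span {i. 0 \<le> i \<or> odd i}"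
    by (rule ex_laurent_solution) blast
  have "mu_gf = Z"
    by (rule ode_unique[OF mu_gf_ode Z(3) mu_gf_initial Z(1,2)])
  then have "mu_egf l = Z $ l"
    by (auto simp: mu_gf_def)
  with span obtain M where "mu_egf l = laurent_eval M u_fps"
    and "Poly_Mapping.keys M \<subseteq> {i. 0 \<le> i \<or> odd i}"
    using laurent_span_imp_laurent_eval by metis
  then show ?thesis
    by (intro exI[of _ M]) (auto simp: in_keys_iff subset_iff)
qed

end
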